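(* Let $N:\mathbb{C}^n\to\mathbb{C}^n$ be a nilpotent morphism of the form $N=N_{(k_1)}+N_{(k_2)}$, where $N_{(k_i)}:\mathbb{C}^n\to\mathbb{C}^n$, $i=1,2$, are morphisms defined by homogeneous forms of degree $k_i>0$. Then $N$ possesses at most one fixed point.
   Context: A morphism $N=(N_1,\dots,N_n):\mathbb{C}^n\to\mathbb{C}^n$ is a mapping given by polynomials $N_i\in\mathbb{C}[X_1,\dots,X_n]$. It is nilpotent if its Jacobi matrix $JN(X)=\left(\frac{\partial N_i}{\partial X_j}\right)$ satisfies $(JN(X))^n\equiv 0$ in the ring of $n\times n$ matrices over $\mathbb{C}[X_1,\dots,X_n]$. A morphism is defined by homogeneous forms of degree $k$ if each of its component polynomials is homogeneous of degree $k$ (or zero). A fixed point of $N$ is a point $x\in\mathbb{C}^n$ with $N(x)=x$. *)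

theory Defs
  imports "HOL-Analysis.Analysis" "HOL-Library.Poly_Mapping"
begin

text \<open>
  Formal polynomials over \<open>\<complex>\<close> in variables indexed by the finite type \<open>'n\<close>: finitely supported
  maps from monomials (exponent vectors) to coefficients, with the convolution product of
  \<^type>\<open>poly_mapping\<close>. The dimension \<open>n\<close> is \<open>CARD('n)\<close>.
\<close>

type_synonym 'n cpoly = "('n \<Rightarrow>\<^sub>0 nat) \<Rightarrow>\<^sub>0 complex"

definition cpoly_eval :: "'n::finite cpoly \<Rightarrow> complex ^ 'n \<Rightarrow> complex" where
  "cpoly_eval p x =
     (\<Sum>m\<in>Poly_Mapping.keys p.
        Poly_Mapping.lookup p m * (\<Prod>i\<in>UNIV. x $ i ^ Poly_Mapping.lookup m i))"

text \<open>
  The subtraction of exponents below is truncated, but it only truncates for monomials that do not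
  contain \<open>X\<^sub>i\<close>, whose coefficient is then \<open>0\<close>.
\<close>

definition cpoly_pderiv :: "'n \<Rightarrow> 'n cpoly \<Rightarrow> 'n cpoly" where
  "cpoly_pderiv i p =
     (\<Sum>m\<in>Poly_Mapping.keys p.
        Poly_Mapping.single (m - Poly_Mapping.single i 1)
          (of_nat (Poly_Mapping.lookup m i) * Poly_Mapping.lookup p m))"

text \<open>The zero polynomial is homogeneous of every degree.\<close>

definition cpoly_homogeneous :: "nat \<Rightarrow> 'n::finite cpoly \<Rightarrow> bool" where
  "cpoly_homogeneous k p \<longleftrightarrow>
     (\<forall>m\<in>Poly_Mapping.keys p. (\<Sum>i\<in>UNIV. Poly_Mapping.lookup m i) = k)"

text \<open>
  A morphism \<open>\<complex>\<^sup>n \<rightarrow> \<complex>\<^sup>n\<close> is represented by its tuple of component polynomials; sums of morphisms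
  are the componentwise sums in \<^type>\<open>vec\<close>.
\<close>

type_synonym 'n morphism = "'n cpoly ^ 'n"

definition morphism_map :: "'n::finite morphism \<Rightarrow> complex ^ 'n \<Rightarrow> complex ^ 'n" where
  "morphism_map N x = (\<chi> i. cpoly_eval (N $ i) x)"

definition jacobi_matrix :: "'n::finite morphism \<Rightarrow> 'n cpoly ^ 'n ^ 'n" where
  "jacobi_matrix N = (\<chi> i j. cpoly_pderiv j (N $ i))"

primrec matrix_power :: "'a::semiring_1 ^ 'n ^ 'n \<Rightarrow> nat \<Rightarrow> 'a ^ 'n ^ 'n" where
  "matrix_power A 0 = mat 1"
| "matrix_power A (Suc k) = A ** matrix_power A k"

definition nilpotent_morphism :: "'n::finite morphism \<Rightarrow> bool" where
  "nilpotent_morphism N \<longleftrightarrow> matrix_power (jacobi_matrix N) CARD('n) = 0"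

definition homogeneous_morphism :: "nat \<Rightarrow> 'n::finite morphism \<Rightarrow> bool" where
  "homogeneous_morphism k N \<longleftrightarrow> (\<forall>i. cpoly_homogeneous k (N $ i))"

definition fixed_point :: "'n::finite morphism \<Rightarrow> complex ^ 'n \<Rightarrow> bool" where
  "fixed_point N x \<longleftrightarrow> morphism_map N x = x"

end

theory Submission
  imports Defs
begin

text \<open>
  If \<open>x\<close> is a fixed point and \<open>y = tx\<close>, Euler's identity gives
  \<open>JN(y) y = k\<^sub>1 t ^ k\<^sub>1 N\<^sub>1(x) + k\<^sub>2 t ^ k\<^sub>2 N\<^sub>2(x)\<close>. Choosing \<open>t > 0\<close> with
  \<open>k\<^sub>1 t ^ k\<^sub>1 = k\<^sub>2 t ^ k\<^sub>2 = c\<close> turns the right-hand side into \<open>c x = (c / t) y\<close>, so \<open>y\<close> would be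
  an eigenvector of the nilpotent matrix \<open>JN(y)\<close> for a nonzero eigenvalue unless \<open>x = 0\<close>.
\<close>

definition monom_eval :: "('n::finite \<Rightarrow>\<^sub>0 nat) \<Rightarrow> complex ^ 'n \<Rightarrow> complex" where
  "monom_eval m x = (\<Prod>i\<in>UNIV. x $ i ^ Poly_Mapping.lookup m i)"

lemma monom_eval_0 [simp]: "monom_eval 0 x = 1"
  by (simp add: monom_eval_def)

lemma monom_eval_add: "monom_eval (m + m') x = monom_eval m x * monom_eval m' x"
  by (simp add: monom_eval_def lookup_add power_add prod.distrib)

lemma monom_eval_single: "monom_eval (Poly_Mapping.single i e) x = x $ i ^ e"
proof -
  have "monom_eval (Poly_Mapping.single i e) x = (\<Prod>j\<in>UNIV. if j = i then x $ j ^ e else 1)"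
    unfolding monom_eval_def by (intro prod.cong) (auto simp: lookup_single when_def)
  then show ?thesis by simp
qed

lemma monom_eval_scale:
  "monom_eval m (t *s x) = t ^ (\<Sum>i\<in>UNIV. Poly_Mapping.lookup m i) * monom_eval m x"
  by (simp add: monom_eval_def power_mult_distrib prod.distrib power_sum)

text \<open>Terms outside the support contribute 0. The freedom in \<open>S\<close> lets
  \<open>p\<close>, \<open>q\<close> and \<open>p + q\<close> be expanded over one common index set,
  although cancellation may shrink the support of the sum.\<close>

lemma cpoly_eval_eq_sum:
  assumes "finite S" "Poly_Mapping.keys p \<subseteq> S"
  shows "cpoly_eval p x = (\<Sum>m\<in>S. Poly_Mapping.lookup p m * monom_eval m x)"
  unfolding cpoly_eval_def monom_eval_def
  by (rule sum.mono_neutral_left) (use assms in \<open>auto simp: in_keys_iff\<close>)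

lemma cpoly_eval_keys:
  "cpoly_eval p x = (\<Sum>m\<in>Poly_Mapping.keys p. Poly_Mapping.lookup p m * monom_eval m x)"
  by (rule cpoly_eval_eq_sum) auto

lemma cpoly_eval_0 [simp]: "cpoly_eval 0 x = 0"
  by (simp add: cpoly_eval_def)

lemma cpoly_eval_single [simp]: "cpoly_eval (Poly_Mapping.single m a) x = a * monom_eval m x"
  by (subst cpoly_eval_eq_sum[of "{m}"]) auto

lemma cpoly_eval_1 [simp]: "cpoly_eval 1 x = 1"
  using cpoly_eval_single[of 0 1 x] by simp

lemma cpoly_eval_add: "cpoly_eval (p + q) x = cpoly_eval p x + cpoly_eval q x"
proof -
  let ?S = "Poly_Mapping.keys p \<union> Poly_Mapping.keys q"
  have "Poly_Mapping.keys (p + q) \<subseteq> ?S" by (rule Poly_Mapping.keys_add)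
  then show ?thesis
    by (simp add: cpoly_eval_eq_sum[of ?S] lookup_add algebra_simps sum.distrib)
qed

lemma cpoly_eval_sum: "cpoly_eval (\<Sum>i\<in>I. f i) x = (\<Sum>i\<in>I. cpoly_eval (f i) x)"
  by (induction I rule: infinite_finite_induct) (auto simp: cpoly_eval_add)

lemma cpoly_eval_mult: "cpoly_eval (p * q) x = cpoly_eval p x * cpoly_eval q x"
proof -
  \<comment> \<open>Writing both factors as sums of single terms reduces the convolution product to
    products of single terms, where exponents add and \<open>monom_eval\<close> is
    multiplicative.\<close>
  have decomp: "r = (\<Sum>m\<in>Poly_Mapping.keys r. Poly_Mapping.single m (Poly_Mapping.lookup r m))"
    for r :: "'a cpoly"
    by (rule poly_mapping_eqI)
       (auto simp: lookup_sum lookup_single when_def sum.delta in_keys_iff)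
  have "p * q = (\<Sum>m\<in>Poly_Mapping.keys p. \<Sum>l\<in>Poly_Mapping.keys q.
      Poly_Mapping.single (m + l) (Poly_Mapping.lookup p m * Poly_Mapping.lookup q l))"
    by (subst decomp[of p], subst decomp[of q]) (simp add: sum_product mult_single)
  then have "cpoly_eval (p * q) x = (\<Sum>m\<in>Poly_Mapping.keys p. \<Sum>l\<in>Poly_Mapping.keys q.
      Poly_Mapping.lookup p m * Poly_Mapping.lookup q l * monom_eval (m + l) x)"
    by (simp add: cpoly_eval_sum)
  also have "\<dots> = cpoly_eval p x * cpoly_eval q x"
    unfolding cpoly_eval_keys by (simp add: sum_product monom_eval_add mult_ac)
  finally show ?thesis .
qed

text \<open>The common factor makes truncated subtraction harmless: if the exponent of
  \<open>i\<close> is 0, both sides vanish; otherwise the subtraction is exact.\<close>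

lemma monom_eval_diff_single:
  "of_nat (Poly_Mapping.lookup m i) * monom_eval (m - Poly_Mapping.single i 1) x * x $ i =
     of_nat (Poly_Mapping.lookup m i) * monom_eval m x"
proof (cases "Poly_Mapping.lookup m i = 0")
  case False
  have "m = (m - Poly_Mapping.single i 1) + Poly_Mapping.single i 1"
    by (rule poly_mapping_eqI)
       (use False in \<open>auto simp: lookup_add lookup_minus lookup_single when_def\<close>)
  then have "monom_eval m x = monom_eval (m - Poly_Mapping.single i 1) x * x $ i"
    by (metis monom_eval_add monom_eval_single power_one_right)
  then show ?thesis by simp
qed simp

text \<open>Differentiating by variable \<open>j\<close> and multiplying by \<open>x $ j\<close>
  scales each monomial by its exponent at \<open>j\<close>. Summed over \<open>j\<close>, these
  factors add up to the total degree \<open>k\<close>.\<close>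

lemma cpoly_euler:
  assumes "cpoly_homogeneous k p"
  shows "(\<Sum>j\<in>UNIV. cpoly_eval (cpoly_pderiv j p) x * x $ j) = of_nat k * cpoly_eval p x"
proof -
  let ?c = "Poly_Mapping.lookup p"
  have "cpoly_eval (cpoly_pderiv j p) x * x $ j =
      (\<Sum>m\<in>Poly_Mapping.keys p. of_nat (Poly_Mapping.lookup m j) * (?c m * monom_eval m x))" for j
  proof -
    have "cpoly_eval (cpoly_pderiv j p) x * x $ j =
        (\<Sum>m\<in>Poly_Mapping.keys p. ?c m *
           (of_nat (Poly_Mapping.lookup m j) * monom_eval (m - Poly_Mapping.single j 1) x * x $ j))"
      by (simp add: cpoly_pderiv_def cpoly_eval_sum sum_distrib_left sum_distrib_right mult_ac)
    then show ?thesis by (simp only: monom_eval_diff_single) (simp add: mult_ac)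
  qed
  then have "(\<Sum>j\<in>UNIV. cpoly_eval (cpoly_pderiv j p) x * x $ j) =
      (\<Sum>m\<in>Poly_Mapping.keys p.
         of_nat (\<Sum>j\<in>UNIV. Poly_Mapping.lookup m j) * (?c m * monom_eval m x))"
    by (simp add: sum.swap[of _ UNIV] sum_distrib_right)
  \<comment> \<open>The exponent sum has to stay inside \<open>of_nat\<close> here, so that
    homogeneity can replace it by \<open>k\<close>.\<close>
  also have "\<dots> = (\<Sum>m\<in>Poly_Mapping.keys p. of_nat k * (?c m * monom_eval m x))"
    using assms by (intro sum.cong) (auto simp: cpoly_homogeneous_def simp del: of_nat_sum)
  finally show ?thesis by (simp add: cpoly_eval_keys sum_distrib_left)
qed

lemma cpoly_eval_homogeneous_scale:
  assumes "cpoly_homogeneous k p"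
  shows "cpoly_eval p (t *s x) = t ^ k * cpoly_eval p x"
  using assms unfolding cpoly_eval_keys sum_distrib_left
  by (intro sum.cong) (auto simp: cpoly_homogeneous_def monom_eval_scale)

lemma cpoly_pderiv_eq_sum:
  assumes "finite S" "Poly_Mapping.keys p \<subseteq> S"
  shows "cpoly_pderiv i p = (\<Sum>m\<in>S. Poly_Mapping.single (m - Poly_Mapping.single i 1)
           (of_nat (Poly_Mapping.lookup m i) * Poly_Mapping.lookup p m))"
  unfolding cpoly_pderiv_def
  by (rule sum.mono_neutral_left) (use assms in \<open>auto simp: in_keys_iff\<close>)

lemma cpoly_pderiv_add: "cpoly_pderiv i (p + q) = cpoly_pderiv i p + cpoly_pderiv i q"
proof -
  let ?S = "Poly_Mapping.keys p \<union> Poly_Mapping.keys q"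
  have "Poly_Mapping.keys (p + q) \<subseteq> ?S" by (rule Poly_Mapping.keys_add)
  then show ?thesis
    by (simp add: cpoly_pderiv_eq_sum[of ?S] lookup_add distrib_left single_add sum.distrib)
qed

definition matrix_eval :: "'n::finite cpoly ^ 'm ^ 'l \<Rightarrow> complex ^ 'n \<Rightarrow> complex ^ 'm ^ 'l" where
  "matrix_eval A x = (\<chi> i j. cpoly_eval (A $ i $ j) x)"

lemma matrix_eval_mult: "matrix_eval (A ** B) x = matrix_eval A x ** matrix_eval B x"
  by (simp add: matrix_eval_def matrix_matrix_mult_def cpoly_eval_sum cpoly_eval_mult vec_eq_iff)

text \<open>Evaluation at a point is a ring homomorphism, so it commutes with matrix powers. This
  carries nilpotency of the formal Jacobi matrix over to the complex matrix at every point.\<close>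

lemma matrix_eval_power: "matrix_eval (matrix_power A k) x = matrix_power (matrix_eval A x) k"
proof (induction k)
  case 0
  show ?case by (simp add: matrix_eval_def mat_def vec_eq_iff)
qed (simp add: matrix_eval_mult)

lemma matrix_power_eigenvector:
  fixes A :: "'a::field ^ 'n::finite ^ 'n"
  assumes "A *v y = c *s y"
  shows "matrix_power A k *v y = c ^ k *s y"
proof (induction k)
  case (Suc k)
  then show ?case
    using assms
    by (simp add: matrix_vector_mul_assoc[symmetric] vector_scalar_commute
        vector_smult_assoc mult.commute)
qed simp

text \<open>The power of the evaluated matrix that vanishes also multiplies \<open>y\<close> by the
  same power of \<open>c\<close>, which must therefore be 0.\<close>

lemma nilpotent_morphism_eigenvalue:
  assumes "nilpotent_morphism N" "matrix_eval (jacobi_matrix N) x *v y = c *s y" "y \<noteq> 0"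
  shows "c = 0"
proof -
  have "matrix_power (matrix_eval (jacobi_matrix N) x) CARD('a) = 0"
    using assms(1) unfolding nilpotent_morphism_def matrix_eval_power[symmetric]
    by (simp add: matrix_eval_def vec_eq_iff)
  then have "c ^ CARD('a) *s y = 0"
    using matrix_power_eigenvector[OF assms(2), of "CARD('a)"] by simp
  then show ?thesis using assms(3) by (simp add: vector_mul_eq_0)
qed

text \<open>Euler's identity is applied componentwise at the scaled point, and homogeneity then
  pulls the power of \<open>t\<close> out, leaving the value at \<open>x\<close> itself.\<close>

lemma jacobi_matrix_euler:
  assumes "homogeneous_morphism k N"
  shows "matrix_eval (jacobi_matrix N) (t *s x) *v (t *s x) = (of_nat k * t ^ k) *s morphism_map N x"
  unfolding vec_eq_iff
proof
  fix i
  from assms have hom: "cpoly_homogeneous k (N $ i)" by (simp add: homogeneous_morphism_def)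
  show "(matrix_eval (jacobi_matrix N) (t *s x) *v (t *s x)) $ i =
      ((of_nat k * t ^ k) *s morphism_map N x) $ i"
    using cpoly_euler[OF hom, of "t *s x"]
    by (simp add: matrix_eval_def jacobi_matrix_def matrix_vector_mult_def morphism_map_def
        cpoly_eval_homogeneous_scale[OF hom])
qed

lemma jacobi_matrix_eval_add:
  "matrix_eval (jacobi_matrix (M + N)) x =
     matrix_eval (jacobi_matrix M) x + matrix_eval (jacobi_matrix N) x"
  by (simp add: matrix_eval_def jacobi_matrix_def cpoly_pderiv_add cpoly_eval_add vec_eq_iff)

lemma morphism_map_add: "morphism_map (M + N) x = morphism_map M x + morphism_map N x"
  by (simp add: morphism_map_def cpoly_eval_add vec_eq_iff)

lemma ex_balancing_scale:
  assumes "k > 0" "l > 0"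
  shows "\<exists>t::real. t > 0 \<and> real k * t ^ k = real l * t ^ l"
proof (cases "k = l")
  case True
  then show ?thesis by (intro exI[of _ 1]) auto
next
  case False
  \<comment> \<open>With \<open>t = exp s\<close>, taking logarithms turns the balancing equation
    into a linear one in \<open>s\<close>, solvable because the degrees differ.\<close>
  define s where "s = (ln (real l) - ln (real k)) / (real k - real l)"
  have "ln (real k) + real k * s = ln (real l) + real l * s"
    using False by (simp add: s_def field_simps)
  then have "exp (ln (real k) + real k * s) = exp (ln (real l) + real l * s)"
    by simp
  then have "real k * exp s ^ k = real l * exp s ^ l"
    using assms by (simp add: exp_add exp_of_nat_mult)
  then show ?thesis by (intro exI[of _ "exp s"]) simp
qed

theorem proposition3:
  fixes N N1 N2 :: "'n::finite morphism" and k1 k2 :: nat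
  assumes "nilpotent_morphism N"
    and "N = N1 + N2"
    and "homogeneous_morphism k1 N1" and "k1 > 0"
    and "homogeneous_morphism k2 N2" and "k2 > 0"
  shows "\<exists>\<^sub>\<le>\<^sub>1 x. fixed_point N x"
proof -
  obtain t :: real where t: "t > 0" "real k1 * t ^ k1 = real k2 * t ^ k2"
    using ex_balancing_scale assms(4,6) by blast
  define z c where "z = complex_of_real t" and "c = of_nat k1 * z ^ k1"
  have "c = complex_of_real (real k1 * t ^ k1)" by (simp add: c_def z_def)
  \<comment> \<open>The balanced choice of \<open>t\<close> gives \<open>c\<close> a second form, so
    both homogeneous parts receive the same factor in Euler's identity.\<close>
  then have c2: "c = of_nat k2 * z ^ k2" unfolding t(2) by (simp add: z_def)
  have nz: "z \<noteq> 0" "c \<noteq> 0" using t(1) assms(4) by (auto simp: z_def c_def)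
  \<comment> \<open>Every fixed point is shown to be the origin, which forces any two of them to
    coincide.\<close>
  have "x = 0" if "fixed_point N x" for x
  proof (rule ccontr)
    assume "x \<noteq> 0"
    have "matrix_eval (jacobi_matrix N) (z *s x) *v (z *s x)
        = c *s morphism_map N1 x + c *s morphism_map N2 x"
      unfolding assms(2) jacobi_matrix_eval_add matrix_vector_mult_add_rdistrib
        jacobi_matrix_euler[OF assms(3)] jacobi_matrix_euler[OF assms(5)]
      by (simp flip: c_def c2)
    also have "\<dots> = c *s morphism_map N x"
      by (simp add: assms(2) morphism_map_add vector_add_ldistrib)
    \<comment> \<open>The fixed point equation replaces \<open>morphism_map N x\<close> by
      \<open>x\<close>; rescaling makes the nonzero vector \<open>z *s x\<close> an eigenvector of
      the matrix at that same point.\<close>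
    also have "\<dots> = (c / z) *s (z *s x)"
      using that nz by (simp add: fixed_point_def vector_smult_assoc)
    finally have "c / z = 0"
      using nilpotent_morphism_eigenvalue[OF assms(1)] nz \<open>x \<noteq> 0\<close>
      by (metis vector_mul_eq_0)
    then show False using nz by simp
  qed
  then show ?thesis unfolding Uniq_def by metis
qed

end
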